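(* Let $\mathcal A$ be a unital commutative Banach algebra and let $\varphi:\mathcal A\to\mathbb C$ be a holomorphic character of the multiplicative semigroup $(\mathcal A,\cdot)$. Then there exist finitely many continuous algebra homomorphisms $\chi_1,\dots,\chi_n:\mathcal A\to\mathbb C$ such that $$\varphi=\chi_1\cdots\chi_n\quad\text{(pointwise product)}.$$
   Context: Banach algebras are complex. A holomorphic character of the multiplicative semigroup $(\mathcal A,\cdot)$ is a holomorphic function $\varphi:\mathcal A\to\mathbb C$ which is multiplicative, i.e. $\varphi(ab)=\varphi(a)\varphi(b)$ for all $a,b\in\mathcal A$. The number $n$ of factors may be $0$, in which case the product is the constant function $1$. *)

theory Defs
  imports "HOL-Analysis.Analysis"
begin

class scaleC =
  fixes scaleC :: "complex \<Rightarrow> 'a \<Rightarrow> 'a"  (infixr "*\<^sub>C" 75)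

class complex_normed_vector = real_normed_vector + scaleC +
  assumes scaleC_add_right: "c *\<^sub>C (x + y) = c *\<^sub>C x + c *\<^sub>C y"
    and scaleC_add_left: "(c + d) *\<^sub>C x = c *\<^sub>C x + d *\<^sub>C x"
    and scaleC_scaleC: "c *\<^sub>C d *\<^sub>C x = (c * d) *\<^sub>C x"
    and scaleC_one: "1 *\<^sub>C x = x"
    and scaleR_scaleC: "r *\<^sub>R x = complex_of_real r *\<^sub>C x"
    and norm_scaleC: "norm (c *\<^sub>C x) = cmod c * norm x"

(* Submultiplicativity of the norm and completeness come from real_normed_algebra and banach.
   The unit comes from comm_monoid_mult rather than comm_ring_1, so neither 0 \<noteq> 1 nor
   norm 1 = 1 is imposed; algebras with a normalised unit are included. *)
class unital_comm_complex_banach_algebra =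
  comm_ring + comm_monoid_mult + real_normed_algebra + complex_normed_vector + banach +
  assumes scaleC_mult_left: "(c *\<^sub>C x) * y = c *\<^sub>C (x * y)"

lemma vector_space_scaleC:
  "vector_space (scaleC :: complex \<Rightarrow> 'a \<Rightarrow> 'a::complex_normed_vector)"
  by unfold_locales (simp_all add: scaleC_add_right scaleC_add_left scaleC_scaleC scaleC_one)

instantiation complex :: unital_comm_complex_banach_algebra
begin

definition scaleC_complex_def [simp]: "c *\<^sub>C (z :: complex) = c * z"

instance
  by standard (simp_all add: algebra_simps norm_mult scaleR_conv_of_real)

end

abbreviation complex_linear ::
  "('a::complex_normed_vector \<Rightarrow> 'b::complex_normed_vector) \<Rightarrow> bool" where
  "complex_linear \<equiv> Vector_Spaces.linear scaleC scaleC"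

(* Complex Frechet differentiability at every point; has_derivative already makes the
   derivative bounded and real-linear. *)
definition holomorphic ::
  "('a::complex_normed_vector \<Rightarrow> 'b::complex_normed_vector) \<Rightarrow> bool" where
  "holomorphic f \<longleftrightarrow> (\<forall>a. \<exists>D. complex_linear D \<and> (f has_derivative D) (at a))"

lemma holomorphic_complex_iff:
  fixes f :: "complex \<Rightarrow> complex"
  shows "holomorphic f \<longleftrightarrow> f holomorphic_on UNIV"
proof
  assume "holomorphic f"
  show "f holomorphic_on UNIV"
    unfolding holomorphic_on_def
  proof
    fix a :: complex
    obtain D where lin: "complex_linear D" and D: "(f has_derivative D) (at a)"
      using \<open>holomorphic f\<close> unfolding holomorphic_def by blast
    interpret D: Vector_Spaces.linear scaleC scaleC D by (rule lin)
    have "D h = D 1 * h" for h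
      using D.scale[of h 1] by simp
    then have "D = (*) (D 1)" by (rule ext)
    with D show "f field_differentiable (at a within UNIV)"
      unfolding field_differentiable_def has_field_derivative_def by metis
  qed
next
  assume f: "f holomorphic_on UNIV"
  show "holomorphic f"
    unfolding holomorphic_def
  proof
    fix a :: complex
    obtain d where d: "(f has_derivative (*) d) (at a)"
      using f unfolding holomorphic_on_def field_differentiable_def has_field_derivative_def
      by auto
    have "complex_linear ((*) d)"
      by unfold_locales (simp_all add: algebra_simps)
    with d show "\<exists>D. complex_linear D \<and> (f has_derivative D) (at a)" by blast
  qed
qed

definition holomorphic_character ::
  "('a::unital_comm_complex_banach_algebra \<Rightarrow> complex) \<Rightarrow> bool" where
  "holomorphic_character \<phi> \<longleftrightarrow> holomorphic \<phi> \<and> (\<forall>a b. \<phi> (a * b) = \<phi> a * \<phi> b)"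

(* Not required to preserve the unit: the zero map is allowed.  It has to be, because the
   constant function 0 is a holomorphic character. *)
definition algebra_hom ::
  "('a::unital_comm_complex_banach_algebra \<Rightarrow> complex) \<Rightarrow> bool" where
  "algebra_hom h \<longleftrightarrow> complex_linear h \<and> (\<forall>a b. h (a * b) = h a * h b)"

end

theory Submission
  imports Defs "HOL-Complex_Analysis.Complex_Analysis"
    "HOL-Computational_Algebra.Fundamental_Theorem_Algebra"
begin

text \<open>
  Unless \<open>\<phi> = 0\<close>, the restriction of \<open>\<phi>\<close> to the scalars is \<open>c \<mapsto> c\<^sup>n\<close>, so \<open>\<phi>\<close> is homogeneous
  of degree \<open>n\<close> and, by Liouville, polynomial of degree at most \<open>n\<close> along every line. Hence
  \<open>\<phi>(t - a)\<close> is a monic polynomial in \<open>t\<close> with \<open>n\<close> roots, which behave like eigenvalues of \<open>a\<close>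
  with \<open>\<phi>\<close> as the determinant. Induct on \<open>n\<close>. If every \<open>a\<close> has only one root \<open>\<theta>(a)\<close>, then
  \<open>n \<theta>\<close> is the derivative of \<open>\<phi>\<close> at \<open>1\<close>, so \<open>\<theta>\<close> is linear; as \<open>\<theta>(a\<^sup>2) = \<theta>(a)\<^sup>2\<close>, it is a
  character and \<open>\<phi> = \<theta>\<^sup>n\<close>. Otherwise a polynomial in an element with two distinct roots gives
  \<open>e\<close> that is idempotent up to an error which \<open>\<phi>\<close> does not see, and
  \<open>\<phi>(x) = \<phi>(x e + (1 - e)) \<phi>(x (1 - e) + e)\<close> splits \<open>\<phi>\<close> into characters of smaller degree.
\<close>

section \<open>Complex scalar multiplication and holomorphy along lines\<close>

lemma scaleC_zero_left [simp]: "0 *\<^sub>C x = (0 :: 'a::complex_normed_vector)"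
  using scaleC_add_left[of 0 0 x] by simp

lemma scaleC_zero_right [simp]: "c *\<^sub>C (0 :: 'a::complex_normed_vector) = 0"
  using scaleC_add_right[of c 0 0] by simp

lemma scaleC_minus_left [simp]: "(- c) *\<^sub>C x = - (c *\<^sub>C x :: 'a::complex_normed_vector)"
  using scaleC_add_left[of c "- c" x] by (simp add: eq_neg_iff_add_eq_0 add.commute)

lemma scaleC_minus_right [simp]: "c *\<^sub>C (- x) = - (c *\<^sub>C x :: 'a::complex_normed_vector)"
  using scaleC_add_right[of c x "- x"] by (simp add: eq_neg_iff_add_eq_0 add.commute)

lemma scaleC_diff_left: "(c - d) *\<^sub>C x = c *\<^sub>C x - d *\<^sub>C (x :: 'a::complex_normed_vector)"
  using scaleC_add_left[of c "- d" x] by simp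

lemma scaleC_diff_right: "c *\<^sub>C (x - y) = c *\<^sub>C x - c *\<^sub>C (y :: 'a::complex_normed_vector)"
  using scaleC_add_right[of c x "- y"] by simp

lemma scaleC_mult_right:
  "x * (c *\<^sub>C y) = c *\<^sub>C (x * (y :: 'a::unital_comm_complex_banach_algebra))"
  using scaleC_mult_left[of c y x] by (simp add: mult.commute)

lemmas scaleC_algebra = scaleC_add_left scaleC_add_right scaleC_diff_left scaleC_diff_right
  scaleC_mult_left scaleC_mult_right scaleC_scaleC scaleC_one

lemma scaleC_power:
  "(c *\<^sub>C x) ^ k = (c ^ k) *\<^sub>C (x ^ k :: 'a::unital_comm_complex_banach_algebra)"
  by (induction k) (simp_all add: scaleC_algebra mult.commute)

lemma bounded_linear_scaleC_left:
  "bounded_linear (\<lambda>c. c *\<^sub>C (x :: 'a::complex_normed_vector))"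
proof (rule bounded_linear_intro[where K = "norm x"])
  show "(r *\<^sub>R c) *\<^sub>C x = r *\<^sub>R c *\<^sub>C x" for r c
    by (simp add: scaleR_scaleC scaleC_scaleC scaleR_conv_of_real)
qed (simp_all add: scaleC_add_left norm_scaleC)

lemma holomorphic_along_line:
  fixes f :: "'a::complex_normed_vector \<Rightarrow> complex"
  assumes "complex_linear D" and "(f has_derivative D) (at (x + t *\<^sub>C a))"
  shows "((\<lambda>t. f (x + t *\<^sub>C a)) has_field_derivative D a) (at t)"
proof -
  interpret D: Vector_Spaces.linear scaleC scaleC D by (rule assms)
  have "((\<lambda>t. x + t *\<^sub>C a) has_derivative (\<lambda>t. t *\<^sub>C a)) (at t)"
    by (auto intro!: derivative_eq_intros
        bounded_linear.has_derivative[OF bounded_linear_scaleC_left])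
  from has_derivative_compose[OF this assms(2)] show ?thesis
    by (simp add: has_field_derivative_def D.scale mult.commute[of _ "D a"])
qed

lemma holomorphic_on_line:
  fixes f :: "'a::complex_normed_vector \<Rightarrow> complex"
  assumes "holomorphic f"
  shows "(\<lambda>t. f (x + t *\<^sub>C a)) holomorphic_on S"
  unfolding holomorphic_on_def
proof
  fix t
  obtain D where "complex_linear D" "(f has_derivative D) (at (x + t *\<^sub>C a))"
    using assms unfolding holomorphic_def by blast
  from holomorphic_along_line[OF this]
  show "(\<lambda>t. f (x + t *\<^sub>C a)) field_differentiable (at t within S)"
    unfolding field_differentiable_def using has_field_derivative_at_within by blast
qed

section \<open>Invertibility by the Neumann series\<close>

lemma neumann_inverse:
  fixes z :: "'a::unital_comm_complex_banach_algebra"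
  assumes "norm z < 1"
  shows "\<exists>u. (1 - z) * u = 1"
proof -
  \<comment> \<open>Exponent 0 is left out: the unit is not normalised, so \<open>norm 1\<close> may
    exceed 1.\<close>
  have le: "norm (z ^ Suc k) \<le> norm z ^ Suc k" for k
  proof (induction k)
    case (Suc k)
    have "norm (z * z ^ Suc k) \<le> norm z * norm (z ^ Suc k)" by (rule norm_mult_ineq)
    also have "\<dots> \<le> norm z * norm z ^ Suc k" by (rule mult_left_mono[OF Suc]) simp
    finally show ?case by simp
  qed simp
  have "summable (\<lambda>k. z ^ Suc k)"
    by (rule summable_comparison_test'[where g = "\<lambda>k. norm z ^ Suc k" and N = 0])
      (use assms le in \<open>auto simp: summable_Suc_iff intro!: summable_geometric\<close>)
  then have s: "summable (\<lambda>k. z ^ k)"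
    using summable_Suc_iff by blast
  then have "(\<lambda>k. (1 - z) * z ^ k) sums ((1 - z) * (\<Sum>k. z ^ k))"
    using bounded_linear.sums[OF bounded_linear_mult_right] summable_sums by blast
  moreover have "(\<lambda>k. (1 - z) * z ^ k) sums 1"
  proof -
    have "(\<lambda>k. z ^ k - z ^ Suc k) sums (z ^ 0 - 0)"
      by (rule telescope_sums') (rule summable_LIMSEQ_zero[OF s])
    then show ?thesis by (simp add: algebra_simps)
  qed
  ultimately show ?thesis using sums_unique2 by blast
qed

lemma large_scalar_plus_invertible:
  fixes w :: "'a::unital_comm_complex_banach_algebra"
  assumes "norm w < cmod l"
  shows "\<exists>u. (l *\<^sub>C 1 + w) * u = 1"
proof -
  from assms have l: "l \<noteq> 0" using norm_ge_zero[of w] by auto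
  have "norm ((- inverse l) *\<^sub>C w) < 1"
    using assms l by (simp add: norm_scaleC norm_inverse norm_divide field_simps)
  from neumann_inverse[OF this] obtain u where "(1 - (- inverse l) *\<^sub>C w) * u = 1" by blast
  then have "(l *\<^sub>C 1 + w) * (inverse l *\<^sub>C u) = 1"
    using l by (simp add: algebra_simps scaleC_algebra)
  then show ?thesis by blast
qed

section \<open>Polynomials evaluated in the algebra\<close>

text \<open>Horner's scheme; \<open>poly\<close> would require coefficients in the algebra
  itself.\<close>

definition ev :: "complex poly \<Rightarrow> 'a::unital_comm_complex_banach_algebra \<Rightarrow> 'a" where
  "ev p a = fold_coeffs (\<lambda>c r. c *\<^sub>C 1 + a * r) p 0"

lemma ev_0 [simp]: "ev 0 a = 0"
  by (simp add: ev_def)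

lemma ev_pCons [simp]: "ev (pCons c p) a = c *\<^sub>C 1 + a * ev p a"
  by (cases "p = 0 \<and> c = 0") (auto simp: ev_def)

lemma ev_1 [simp]: "ev 1 a = 1"
  by (simp add: one_pCons scaleC_one)

lemma ev_add [simp]: "ev (p + q) a = ev p a + ev q a"
  by (induction p q rule: poly_induct2) (auto simp: scaleC_algebra algebra_simps)

lemma ev_smult [simp]: "ev (smult c p) a = c *\<^sub>C ev p a"
  by (induction p) (auto simp: scaleC_algebra)

lemma ev_mult [simp]: "ev (p * q) a = ev p a * ev q a"
  by (induction p) (auto simp: scaleC_algebra algebra_simps)

lemma ev_diff [simp]: "ev (p - q) a = ev p a - ev q a"
  using ev_add[of "p - q" q a] by (simp add: algebra_simps)

lemma ev_power [simp]: "ev (p ^ k) a = ev p a ^ k"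
  by (induction k) auto

section \<open>Entire functions, polynomials and roots of unity\<close>

text \<open>Comparing k-th derivatives of \<open>f (x * w) = f x * f w\<close> in \<open>w\<close>
  at 0 gives \<open>f x = x ^ k\<close> as soon as the k-th derivative of \<open>f\<close> at 0 is
  nonzero. If all of them vanish, \<open>f\<close> is constant and the exponent is 0.\<close>

lemma entire_multiplicative_is_power:
  fixes f :: "complex \<Rightarrow> complex"
  assumes hol: "f holomorphic_on UNIV" and mult: "\<And>x y. f (x * y) = f x * f y" and "f 1 = 1"
  shows "\<exists>n. \<forall>x. f x = x ^ n"
proof -
  have *: "x ^ k * (deriv ^^ k) f 0 = f x * (deriv ^^ k) f 0" for x k
  proof -
    have "(deriv ^^ k) (\<lambda>w. f (x * w)) 0 = x ^ k * (deriv ^^ k) f (x * 0)"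
      by (rule higher_deriv_compose_linear[where S = UNIV, OF hol]) auto
    moreover have "(deriv ^^ k) (\<lambda>w. f x * f w) 0 = f x * (deriv ^^ k) f 0"
      by (rule higher_deriv_cmult[OF hol]) auto
    ultimately show ?thesis by (simp only: mult mult_zero_right)
  qed
  show ?thesis
  proof (cases "\<exists>k. (deriv ^^ k) f 0 \<noteq> 0")
    case True
    with * show ?thesis by (metis mult_cancel_right)
  next
    case False
    have "f w = f 0" for w
      by (rule holomorphic_fun_eq_const_on_connected[OF hol]) (use False in auto)
    with \<open>f 1 = 1\<close> have "f w = w ^ 0" for w by (metis power_0)
    then show ?thesis by blast
  qed
qed

text \<open>A nonzero polynomial has a bounded set of roots. This extends identities proved only for
  nonzero or large scalars to all scalars.\<close>

lemma poly_eq_iff_outside_ball: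
  fixes p q :: "complex poly"
  assumes "\<And>z. cmod z > r \<Longrightarrow> poly p z = poly q z"
  shows "p = q"
proof (rule ccontr)
  assume "p \<noteq> q"
  then have "finite {z. poly (p - q) z = 0}" by (intro poly_roots_finite) simp
  then have "bounded {z. poly (p - q) z = 0}" by (rule finite_imp_bounded)
  then obtain B where B: "\<And>z. poly (p - q) z = 0 \<Longrightarrow> cmod z \<le> B"
    unfolding bounded_iff by blast
  have "poly (p - q) (of_real (\<bar>r\<bar> + \<bar>B\<bar> + 1)) = 0"
    using assms[of "of_real (\<bar>r\<bar> + \<bar>B\<bar> + 1)"] by (simp del: of_real_add)
  from B[OF this] show False by (simp del: of_real_add)
qed

text \<open>A geometric sum with ratio \<open>\<omega> ^ k\<close>, which is 1 exactly when
  \<open>N dvd k\<close>. It serves as a filter that isolates coefficients.\<close>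

lemma sum_root_of_unity_power:
  fixes N k :: nat
  assumes "0 < N" and \<omega>: "\<omega> = exp (2 * of_real pi * \<i> / of_nat N)"
  shows "(\<Sum>m<N. (\<omega> ^ m) ^ k) = (if N dvd k then of_nat N else 0)"
proof -
  have pow: "\<omega> ^ k = exp (2 * of_real pi * \<i> * of_nat k / of_nat N)" for k
    by (simp add: \<omega> exp_of_nat_mult[symmetric] mult_ac)
  have one: "\<omega> ^ k = 1 \<longleftrightarrow> N dvd k" for k
    unfolding pow by (rule complex_root_unity_eq_1) (use assms in auto)
  have "(\<Sum>m<N. (\<omega> ^ m) ^ k) = (\<Sum>m<N. (\<omega> ^ k) ^ m)"
    by (simp add: power_mult[symmetric] mult.commute)
  also have "\<dots> = (if N dvd k then of_nat N else 0)"
  proof (cases "N dvd k")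
    case True
    with one[of k] show ?thesis by simp
  next
    case False
    have "(1 - \<omega> ^ k) * (\<Sum>m<N. (\<omega> ^ k) ^ m) = 1 - (\<omega> ^ k) ^ N"
      by (rule one_diff_power_eq[symmetric])
    also have "(\<omega> ^ k) ^ N = 1"
      using one[of "k * N"] by (simp add: power_mult[symmetric])
    finally show ?thesis using one[of k] False by simp
  qed
  finally show ?thesis .
qed

section \<open>Homogeneous characters and their characteristic polynomials\<close>

locale homogeneous_character =
  fixes \<phi> :: "'a::unital_comm_complex_banach_algebra \<Rightarrow> complex" and n :: nat
  assumes hol: "holomorphic \<phi>"
    and mult: "\<phi> (a * b) = \<phi> a * \<phi> b"
    and scalar: "\<phi> (c *\<^sub>C 1) = c ^ n"
begin

lemma phi_one [simp]: "\<phi> 1 = 1"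
  using scalar[of 1] by (simp add: scaleC_one)

lemma phi_scaleC: "\<phi> (c *\<^sub>C a) = c ^ n * \<phi> a"
  using mult[of "c *\<^sub>C 1" a] by (simp add: scaleC_algebra scalar)

lemma phi_minus: "\<phi> (- a) = (-1) ^ n * \<phi> a"
  using phi_scaleC[of "-1" a] by (simp add: scaleC_one)

text \<open>For nonzero \<open>z\<close>, \<open>\<phi> (x + z *\<^sub>C a) = z ^ n * \<phi>
  (inverse z *\<^sub>C x + a)\<close>, and \<phi> is bounded near \<open>a\<close>; so the growth
  along the line is at most of order \<open>n\<close>.\<close>

lemma polynomial_along_line:
  "\<exists>p. degree p \<le> n \<and> (\<forall>t. \<phi> (x + t *\<^sub>C a) = poly p t)"
proof -
  have "isCont \<phi> a"
    using hol unfolding holomorphic_def by (blast dest: has_derivative_continuous)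
  then obtain d where d: "d > 0" "\<And>y. dist y a < d \<Longrightarrow> dist (\<phi> y) (\<phi> a) < 1"
    unfolding continuous_at by (metis LIM_def dist_self zero_less_one)
  define f where "f t = \<phi> (x + t *\<^sub>C a)" for t
  have "f holomorphic_on UNIV"
    unfolding f_def by (rule holomorphic_on_line[OF hol])
  \<comment> \<open>Beyond this threshold \<open>z\<close> is nonzero and
    \<open>inverse z *\<^sub>C x\<close> has norm below \<open>d\<close>.\<close>
  have "cmod (f z) \<le> (cmod (\<phi> a) + 1) * cmod z ^ n" if z: "norm x / d + 1 \<le> cmod z" for z
  proof -
    have "norm x / d \<ge> 0" using d by simp
    with z have "cmod z > 0" "norm x / d < cmod z" by linarith+
    then have z0: "z \<noteq> 0" and *: "norm x < d * cmod z" using d by (auto simp: field_simps)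
    have "dist (inverse z *\<^sub>C x + a) a < d"
      using * z0 by (simp add: dist_norm norm_scaleC norm_inverse norm_divide field_simps)
    from d(2)[OF this] have "cmod (\<phi> (inverse z *\<^sub>C x + a)) \<le> cmod (\<phi> a) + 1"
      unfolding dist_norm using norm_triangle_ineq2[of "\<phi> (inverse z *\<^sub>C x + a)" "\<phi> a"] by linarith
    moreover have "x + z *\<^sub>C a = z *\<^sub>C (inverse z *\<^sub>C x + a)"
      using z0 by (simp add: scaleC_algebra)
    ultimately show ?thesis
      using z0 by (simp add: f_def phi_scaleC norm_mult norm_power mult.commute)
  qed
  from Liouville_polynomial[OF \<open>f holomorphic_on UNIV\<close> this]
  have "f t = (\<Sum>k\<le>n. (deriv ^^ k) f 0 / fact k * t ^ k)" for t .
  then have "f t = poly (\<Sum>k\<le>n. monom ((deriv ^^ k) f 0 / fact k) k) t" for t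
    by (simp add: poly_sum poly_monom)
  moreover have "degree (\<Sum>k\<le>n. monom ((deriv ^^ k) f 0 / fact k) k) \<le> n"
    by (rule degree_sum_le) (auto intro: order_trans[OF degree_monom_le])
  ultimately show ?thesis unfolding f_def by blast
qed

text \<open>By homogeneity this is the reversal of the polynomial of
  \<open>1 - t *\<^sub>C a\<close>, whose constant term \<open>\<phi> 1 = 1\<close> becomes the
  leading coefficient.\<close>

lemma char_roots:
  "\<exists>A. size A = n \<and> (\<forall>t. \<phi> (t *\<^sub>C 1 - a) = (\<Prod>x\<in>#A. t - x))"
proof -
  obtain p where p: "degree p \<le> n" "\<And>t. \<phi> (1 + t *\<^sub>C (- a)) = poly p t"
    using polynomial_along_line by metis
  obtain q where q: "\<And>t. \<phi> (- a + t *\<^sub>C 1) = poly q t"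
    using polynomial_along_line by metis
  have p0: "coeff p 0 = 1"
    using p(2)[of 0] by (simp add: poly_0_coeff_0)
  \<comment> \<open>\<open>reflect_poly\<close> reverses relative to \<open>degree p\<close>, which
    may be below \<open>n\<close>; the monomial makes up the difference.\<close>
  define r where "r = monom 1 (n - degree p) * reflect_poly p"
  have "poly q t = poly r t" if "cmod t > 0" for t
  proof -
    have t: "t \<noteq> 0" using that by auto
    have "- a + t *\<^sub>C 1 = t *\<^sub>C (1 + inverse t *\<^sub>C (- a))"
      using t by (simp add: scaleC_algebra)
    then have "poly q t = t ^ n * poly p (inverse t)"
      by (metis q p(2) phi_scaleC)
    also have "\<dots> = poly r t"
      using t p(1) unfolding r_def
      by (simp add: poly_reflect_poly_nz poly_monom power_add[symmetric] mult.assoc[symmetric])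
    finally show ?thesis .
  qed
  then have "q = r" by (rule poly_eq_iff_outside_ball)
  have "p \<noteq> 0" using p0 by auto
  have "lead_coeff r = 1"
    unfolding r_def lead_coeff_mult lead_coeff_monom using p0 by (simp add: coeff_reflect_poly)
  moreover have "degree r = n"
    using p0 p(1) \<open>p \<noteq> 0\<close> by (simp add: r_def degree_mult_eq degree_monom_eq)
  ultimately have r: "degree r = n" "lead_coeff r = 1" by auto
  then have "r \<noteq> 0" by auto
  from alg_closed_imp_factorization[OF this] obtain A
    where A: "size A = n" "r = (\<Prod>x\<in>#A. [:-x, 1:])" using r by auto
  have "\<phi> (t *\<^sub>C 1 - a) = (\<Prod>x\<in>#A. t - x)" for t
  proof -
    have "\<phi> (t *\<^sub>C 1 - a) = poly r t" using q[of t] \<open>q = r\<close> by simp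
    also have "\<dots> = (\<Prod>x\<in>#A. t - x)"
      unfolding A(2) by (simp add: poly_prod_mset image_mset.compositionality o_def)
    finally show ?thesis .
  qed
  with A(1) show ?thesis by blast
qed

text \<open>Both sides are multiplicative in \<open>p\<close>, so linear factors and scalars
  suffice; for a linear factor this is the hypothesis up to the sign
  \<open>(-1) ^ n\<close>.\<close>

lemma spectral_mapping:
  assumes A: "size A = n" "\<And>t. \<phi> (t *\<^sub>C 1 - a) = (\<Prod>x\<in>#A. t - x)"
  shows "\<phi> (ev p a) = (\<Prod>x\<in>#A. poly p x)"
proof (cases "p = 0")
  case True
  \<comment> \<open>Both sides are \<open>0 ^ n\<close>, which is 1 for
    \<open>n = 0\<close>.\<close>
  have "\<phi> 0 = 0 ^ n" using scalar[of 0] by simp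
  then show ?thesis using True A(1) by simp
next
  case False
  have lin: "\<phi> (ev [:- y, 1:] a) = (\<Prod>x\<in>#A. x - y)" for y
  proof -
    have "\<phi> (ev [:- y, 1:] a) = \<phi> (- (y *\<^sub>C 1 - a))" by (simp add: scaleC_one)
    also have "\<dots> = (-1) ^ size A * (\<Prod>x\<in>#A. y - x)" unfolding phi_minus A ..
    also have "\<dots> = (\<Prod>x\<in>#A. x - y)"
    proof (induction A)
      case (add x A)
      then show ?case by (simp add: add.IH[symmetric] algebra_simps)
    qed simp
    finally show ?thesis .
  qed
  have "\<phi> (ev (\<Prod>y\<in>#B. [:-y, 1:]) a)
      = (\<Prod>x\<in>#A. poly (\<Prod>y\<in>#B. [:-y, 1:]) x)" for B
  proof (induction B)
    case (add y B)
    have "\<phi> (ev (\<Prod>y\<in>#add_mset y B. [:-y, 1:]) a)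
        = (\<Prod>x\<in>#A. x - y) * (\<Prod>x\<in>#A. poly (\<Prod>y\<in>#B. [:-y, 1:]) x)"
      by (simp only: image_mset_add_mset prod_mset.add_mset ev_mult mult lin add.IH)
    then show ?case by (simp add: prod_mset.distrib[symmetric] algebra_simps)
  qed simp
  moreover obtain B where B: "p = smult (lead_coeff p) (\<Prod>y\<in>#B. [:-y, 1:])"
    using alg_closed_imp_factorization[OF False] by blast
  moreover have "(\<Prod>x\<in>#A. c * f x) = c ^ n * (\<Prod>x\<in>#A. f x)" for c and f :: "complex \<Rightarrow> complex"
    by (simp add: prod_mset.distrib A)
  ultimately have "\<phi> (ev (smult l q) a) = (\<Prod>x\<in>#A. poly (smult l q) x)"
    if "q = (\<Prod>y\<in>#B. [:-y, 1:])" for l q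
    by (simp add: that phi_scaleC)
  with B show ?thesis by metis
qed

section \<open>Perturbations invisible to the character\<close>

text \<open>The derivative \<open>T\<close> at 1 kills all multiples of \<open>c ^ (n + 1)\<close>.
  Translating by multiplication, so does the derivative at every invertible point. This settles
  \<open>x\<close> shifted by a large scalar, and polynomials in that scalar carry the identity back
  to 0.\<close>

lemma nil_power_negligible:
  assumes nil: "\<And>t. \<phi> (1 + t *\<^sub>C c) = 1"
  shows "\<phi> (x + c ^ (n + 1) * b) = \<phi> x"
proof -
  obtain T where lin: "complex_linear T" and T: "(\<phi> has_derivative T) (at 1)"
    using hol unfolding holomorphic_def by blast
  interpret T: Vector_Spaces.linear scaleC scaleC T by (rule lin)
  have deriv_one: "((\<lambda>t. \<phi> (1 + t *\<^sub>C y)) has_field_derivative T y) (at 0)" for y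
    by (rule holomorphic_along_line[OF lin]) (simp add: T)
  \<comment> \<open>No exponent from 1 to \<open>n + 1\<close> is divisible by \<open>n + 2\<close>,
    and exactly one from 1 to \<open>n + 2\<close> is.\<close>
  define N where "N = n + 2"
  define \<omega> where "\<omega> = exp (2 * of_real pi * \<i> / of_nat N)"
  have N: "0 < N" by (simp add: N_def)
  note root_sum = sum_root_of_unity_power[OF N \<omega>_def]
  have \<omega>N: "(\<omega> ^ m) ^ N = 1" for m
    using complex_root_unity_eq_1[of N "N * m"] N
    by (simp add: \<omega>_def exp_of_nat_mult[symmetric] power_mult[symmetric] mult_ac)
  have T0: "T (c ^ (n + 1) * y) = 0" for y
  proof -
    \<comment> \<open>The cofactor of \<open>1 - (\<omega> ^ m) *\<^sub>C c\<close> in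
      \<open>1 - c ^ N\<close>.\<close>
    define u where "u m = (\<Sum>j<N. ((\<omega> ^ m) *\<^sub>C c) ^ j)" for m
    have u: "1 - c ^ N = (1 - (\<omega> ^ m) *\<^sub>C c) * u m" for m
      using one_diff_power_eq[of "(\<omega> ^ m) *\<^sub>C c" N]
      by (simp add: u_def scaleC_power \<omega>N scaleC_one)
    \<comment> \<open>After multiplication by \<open>1 - c\<^sup>N\<close> the summand is a polynomial of degree at most \<open>n\<close> in \<open>\<omega>\<^sup>m\<close>,
      and the weighted sum reads off its coefficient of degree \<open>N - 1 = n + 1\<close>.\<close>
    have sum0: "(\<Sum>m<N. \<omega> ^ m * \<phi> (1 + t *\<^sub>C (u m * y))) = 0" for t
    proof -
      obtain p where p: "degree p \<le> n"
        "\<And>s. \<phi> ((1 + t *\<^sub>C ((1 - c ^ N) * y)) + s *\<^sub>C (- c)) = poly p s"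
        using polynomial_along_line by metis
      have p_sum: "poly p s = (\<Sum>k\<le>n. coeff p k * s ^ k)" for s
        unfolding poly_altdef using p(1)
        by (intro sum.mono_neutral_left) (auto simp: coeff_eq_0)
      have "\<phi> (1 + t *\<^sub>C (u m * y)) = poly p (\<omega> ^ m)" for m
      proof -
        \<comment> \<open>Multiplying by a factor on which \<phi> is 1 leaves
          \<open>\<omega> ^ m\<close> only in a linear term.\<close>
        have "1 + t *\<^sub>C ((1 - c ^ N) * y) + (\<omega> ^ m) *\<^sub>C (- c)
            = (1 + (- (\<omega> ^ m)) *\<^sub>C c) * (1 + t *\<^sub>C (u m * y))"
          unfolding u[of m] by (simp add: scaleC_algebra algebra_simps)
        then show ?thesis
          using nil[of "- (\<omega> ^ m)"] by (metis mult mult_1 p(2))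
      qed
      then have "(\<Sum>m<N. \<omega> ^ m * \<phi> (1 + t *\<^sub>C (u m * y)))
          = (\<Sum>m<N. \<Sum>k\<le>n. coeff p k * (\<omega> ^ m) ^ Suc k)"
        by (simp add: p_sum sum_distrib_left mult_ac)
      also have "\<dots> = (\<Sum>k\<le>n. coeff p k * (\<Sum>m<N. (\<omega> ^ m) ^ Suc k))"
        by (subst sum.swap) (simp add: sum_distrib_left)
      also have "\<dots> = 0"
        unfolding root_sum by (rule sum.neutral) (auto simp: N_def dest!: dvd_imp_le)
      finally show ?thesis .
    qed
    \<comment> \<open>Differentiating the vanishing sum at 0 gives a relation for \<open>T\<close>,
      in which the root-of-unity filter retains only \<open>j = n + 1\<close>.\<close>
    have "((\<lambda>t. \<Sum>m<N. \<omega> ^ m * \<phi> (1 + t *\<^sub>C (u m * y))) has_field_derivative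
        (\<Sum>m<N. \<omega> ^ m * T (u m * y))) (at 0)"
      by (intro DERIV_sum DERIV_cmult deriv_one)
    then have "(\<Sum>m<N. \<omega> ^ m * T (u m * y)) = 0"
      unfolding sum0 using DERIV_unique DERIV_const by blast
    also have "(\<Sum>m<N. \<omega> ^ m * T (u m * y))
        = (\<Sum>m<N. \<Sum>j<N. (\<omega> ^ m) ^ Suc j * T (c ^ j * y))"
      by (simp add: u_def sum_distrib_right T.sum scaleC_power scaleC_algebra T.scale
          sum_distrib_left mult_ac)
    also have "\<dots> = (\<Sum>j<N. (\<Sum>m<N. (\<omega> ^ m) ^ Suc j) * T (c ^ j * y))"
      by (subst sum.swap) (simp add: sum_distrib_right)
    also have "\<dots> = (\<Sum>j<N. if j = n + 1 then of_nat N * T (c ^ j * y) else 0)"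
      unfolding root_sum by (rule sum.cong) (auto simp: N_def dest!: dvd_imp_le)
    also have "\<dots> = of_nat N * T (c ^ (n + 1) * y)"
      by (subst sum.delta) (auto simp: N_def)
    finally show ?thesis using N by simp
  qed
  define d where "d = c ^ (n + 1) * b"
  \<comment> \<open>The bound makes \<open>l *\<^sub>C 1 + x + s *\<^sub>C d\<close> invertible for
    all \<open>s\<close> in \<open>ball 0 2\<close>, a convex set containing 0 and 1.\<close>
  have large: "\<phi> (l *\<^sub>C 1 + x + d) = \<phi> (l *\<^sub>C 1 + x)" if l: "cmod l > norm x + 2 * norm d" for l
  proof -
    define f where "f s = \<phi> ((l *\<^sub>C 1 + x) + s *\<^sub>C d)" for s
    have "(f has_field_derivative 0) (at s within ball 0 2)" if s: "s \<in> ball 0 2" for s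
    proof -
      have "norm (x + s *\<^sub>C d) \<le> norm x + cmod s * norm d"
        by (metis norm_triangle_ineq norm_scaleC)
      also have "\<dots> \<le> norm x + 2 * norm d"
        using s by (intro add_left_mono mult_right_mono) auto
      finally obtain u where u: "(l *\<^sub>C 1 + (x + s *\<^sub>C d)) * u = 1"
        using large_scalar_plus_invertible[of "x + s *\<^sub>C d" l] l by force
      define y where "y = l *\<^sub>C 1 + (x + s *\<^sub>C d)"
      have "f (h + s) = \<phi> y * \<phi> (1 + h *\<^sub>C (d * u))" for h
      proof -
        have "y * (1 + h *\<^sub>C (d * u)) = y + h *\<^sub>C (d * (y * u))"
          by (simp add: scaleC_algebra algebra_simps)
        also have "\<dots> = (l *\<^sub>C 1 + x) + (h + s) *\<^sub>C d"
          using u by (simp add: y_def scaleC_algebra algebra_simps)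
        finally show ?thesis by (metis f_def mult)
      qed
      moreover have "((\<lambda>h. \<phi> y * \<phi> (1 + h *\<^sub>C (d * u))) has_field_derivative \<phi> y * T (d * u)) (at 0)"
        by (intro DERIV_cmult deriv_one)
      moreover have "T (d * u) = 0"
        using T0[of "b * u"] by (simp add: d_def mult.assoc)
      ultimately have "((\<lambda>h. f (h + s)) has_field_derivative 0) (at 0)" by simp
      then have "(f has_field_derivative 0) (at (0 + s))" by (subst (asm) DERIV_shift[symmetric])
      then show ?thesis by (simp add: has_field_derivative_at_within)
    qed
    then obtain k where "\<And>s. s \<in> ball 0 2 \<Longrightarrow> f s = k"
      using has_field_derivative_zero_constant[OF convex_ball] by metis
    then have "f 1 = f 0" by simp
    then show ?thesis by (simp add: f_def scaleC_one)
  qed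
  obtain p where p: "\<And>l. \<phi> ((x + d) + l *\<^sub>C 1) = poly p l"
    using polynomial_along_line by metis
  obtain q where q: "\<And>l. \<phi> (x + l *\<^sub>C 1) = poly q l"
    using polynomial_along_line by metis
  have "p = q"
    by (rule poly_eq_iff_outside_ball[where r = "norm x + 2 * norm d"])
      (use large in \<open>simp add: p[symmetric] q[symmetric] add_ac\<close>)
  with p[of 0] q[of 0] show ?thesis by (simp add: d_def)
qed

end

section \<open>Splitting along approximate idempotents, and the single-root case\<close>

lemma holomorphic_affine:
  fixes f :: "'a::unital_comm_complex_banach_algebra \<Rightarrow> complex"
  assumes "holomorphic f"
  shows "holomorphic (\<lambda>x. f (x * e + b))"
  unfolding holomorphic_def
proof
  fix a
  obtain D where lin: "complex_linear D" and D: "(f has_derivative D) (at (a * e + b))"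
    using assms unfolding holomorphic_def by blast
  interpret D: Vector_Spaces.linear scaleC scaleC D by (rule lin)
  have "((\<lambda>x. x * e + b) has_derivative (\<lambda>h. h * e)) (at a)"
    by (auto intro!: derivative_eq_intros)
  from has_derivative_compose[OF this D]
  have "((\<lambda>x. f (x * e + b)) has_derivative (\<lambda>h. D (h * e))) (at a)" .
  moreover have "complex_linear (\<lambda>h. D (h * e))"
    by unfold_locales
      (simp_all add: distrib_right D.add D.scale scaleC_mult_left)
  ultimately show "\<exists>D. complex_linear D \<and> ((\<lambda>x. f (x * e + b)) has_derivative D) (at a)"
    by blast
qed

lemma prod_mset_if: "(\<Prod>x\<in>#A. if Q x then t else 1) = t ^ size (filter_mset Q A)"
  by (induction A) auto

context homogeneous_character
begin

text \<open>For a true idempotent \<open>e\<close> the map \<open>x * e + (1 - e)\<close> is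
  multiplicative in \<open>x\<close>; here the defect is a multiple of \<open>e - e * e\<close>,
  which \<phi> ignores.\<close>

lemma corner_character:
  assumes e: "\<And>x y. \<phi> (x + (e - e * e) * y) = \<phi> x"
    and m: "\<And>t. \<phi> (t *\<^sub>C e + (1 - e)) = t ^ m"
  shows "homogeneous_character (\<lambda>x. \<phi> (x * e + (1 - e))) m"
proof
  show "holomorphic (\<lambda>x. \<phi> (x * e + (1 - e)))" by (rule holomorphic_affine[OF hol])
  show "\<phi> (a * b * e + (1 - e)) = \<phi> (a * e + (1 - e)) * \<phi> (b * e + (1 - e))" for a b
  proof -
    have "(a * e + (1 - e)) * (b * e + (1 - e))
        = (a * b * e + (1 - e)) + (e - e * e) * (a + b - a * b - 1)"
      by (simp add: algebra_simps)
    then show ?thesis by (metis e mult)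
  qed
  show "\<phi> ((c *\<^sub>C 1) * e + (1 - e)) = c ^ m" for c
    using m[of c] by (simp add: scaleC_mult_left)
qed

text \<open>The factorisation of \<open>x\<close> along \<open>e\<close> and \<open>1 - e\<close>,
  modulo \<open>e - e * e\<close>. The form \<open>1 - (1 - e)\<close> makes the second factor
  literally the corner of \<open>1 - e\<close>.\<close>

lemma corner_product:
  assumes e: "\<And>x y. \<phi> (x + (e - e * e) * y) = \<phi> x"
  shows "\<phi> x = \<phi> (x * e + (1 - e)) * \<phi> (x * (1 - e) + (1 - (1 - e)))"
proof -
  have "(x * e + (1 - e)) * (x * (1 - e) + (1 - (1 - e)))
      = x + (e - e * e) * (x * x - x - x + 1)"
    by (simp add: algebra_simps)
  then show ?thesis by (metis e mult)
qed

lemma single_root_character: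
  assumes n: "n > 0" and \<theta>: "\<And>a t. \<phi> (t *\<^sub>C 1 - a) = (t - \<theta> a) ^ n"
  shows "algebra_hom \<theta>" and "continuous_on UNIV \<theta>" and "\<phi> a = \<theta> a ^ n"
proof -
  obtain T where lin: "complex_linear T" and T: "(\<phi> has_derivative T) (at 1)"
    using hol unfolding holomorphic_def by blast
  interpret T: Vector_Spaces.linear scaleC scaleC T by (rule lin)
  have line: "\<phi> (1 + t *\<^sub>C a) = (1 + t * \<theta> a) ^ n" for t a
  proof (cases "t = 0")
    case False
    then have "1 + t *\<^sub>C a = (- t) *\<^sub>C ((- inverse t) *\<^sub>C 1 - a)"
      by (simp add: scaleC_algebra)
    then have "\<phi> (1 + t *\<^sub>C a) = (- t) ^ n * (- inverse t - \<theta> a) ^ n"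
      by (simp only: phi_scaleC \<theta>)
    also have "\<dots> = (1 + t * \<theta> a) ^ n"
      using False by (simp add: power_mult_distrib[symmetric] algebra_simps)
    finally show ?thesis .
  qed simp
  have \<theta>T: "\<theta> = (\<lambda>a. inverse (of_nat n) * T a)"
  proof
    fix a
    have "((\<lambda>t. \<phi> (1 + t *\<^sub>C a)) has_field_derivative T a) (at 0)"
      by (rule holomorphic_along_line[OF lin]) (simp add: T)
    moreover have "((\<lambda>t. (1 + t * \<theta> a) ^ n) has_field_derivative of_nat n * \<theta> a) (at 0)"
      by (auto intro!: derivative_eq_intros)
    ultimately have "T a = of_nat n * \<theta> a"
      unfolding line by (rule DERIV_unique)
    with n show "\<theta> a = inverse (of_nat n) * T a" by simp
  qed
  have linear: "complex_linear \<theta>"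
    unfolding \<theta>T by unfold_locales (simp_all add: T.add T.scale algebra_simps)
  interpret \<theta>: Vector_Spaces.linear scaleC scaleC \<theta> by (rule linear)
  have square: "\<theta> (a * a) = \<theta> a * \<theta> a" for a
  proof -
    \<comment> \<open>This choice makes the value of \<phi> at
      \<open>(t * t) *\<^sub>C 1 - a * a\<close> vanish, so \<open>t\<close> is
      \<open>\<theta> a\<close> or its negative.\<close>
    define t where "t = csqrt (\<theta> (a * a))"
    have t: "t * t = \<theta> (a * a)"
      by (metis t_def power2_csqrt power2_eq_square)
    have "(t *\<^sub>C 1 - a) * (t *\<^sub>C 1 - (- a)) = (t * t) *\<^sub>C 1 - a * a"
      by (simp add: scaleC_algebra algebra_simps)
    then have "(t - \<theta> a) ^ n * (t - \<theta> (- a)) ^ n = (t * t - \<theta> (a * a)) ^ n"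
      by (metis \<theta> mult)
    then have "(t - \<theta> a) * (t + \<theta> a) = 0"
      using n by (simp add: t \<theta>.neg power_0_left)
    with t show ?thesis by (simp add: algebra_simps)
  qed
  have "\<theta> (a * b) = \<theta> a * \<theta> b" for a b
  proof -
    \<comment> \<open>Polarisation recovers products from squares.\<close>
    have "\<theta> ((a + b) * (a + b)) = \<theta> (a * a) + \<theta> (b * b) + 2 * \<theta> (a * b)"
      by (simp add: algebra_simps \<theta>.add)
    then show ?thesis
      unfolding square \<theta>.add by (simp add: algebra_simps)
  qed
  with linear show "algebra_hom \<theta>" by (simp add: algebra_hom_def)
  have "bounded_linear T" using T by (rule has_derivative_bounded_linear)
  then show "continuous_on UNIV \<theta>"
    unfolding \<theta>T by (intro continuous_on_mult_left linear_continuous_on)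
  show "\<phi> a = \<theta> a ^ n"
  proof -
    have "(-1) ^ n * \<phi> a = (- \<theta> a) ^ n"
      using \<theta>[of 0 a] by (simp add: phi_minus)
    also have "\<dots> = (-1) ^ n * \<theta> a ^ n" by (rule power_minus)
    finally show ?thesis by simp
  qed
qed

text \<open>If \<open>p\<close> is the indicator of one root on the set of all roots of \<open>a\<close>, then \<open>p(a)\<close> is idempotent up to
  a nil error; the polynomial \<open>1 - (1 - p\<^sup>M)\<^sup>M\<close> keeps the values of \<open>p\<close> there and makes the
  error divisible by an \<open>M\<close>-th power of a nil element, hence invisible to \<open>\<phi>\<close>.\<close>
lemma exists_splitting_element:
  assumes A: "size A = n" "\<And>t. \<phi> (t *\<^sub>C 1 - a) = (\<Prod>x\<in>#A. t - x)"
  shows "\<exists>e. (\<forall>x y. \<phi> (x + (e - e * e) * y) = \<phi> x) \<and>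
    (\<forall>t. \<phi> (t *\<^sub>C e + (1 - e)) = t ^ size (filter_mset (\<lambda>x. x = r) A)) \<and>
    (\<forall>t. \<phi> (t *\<^sub>C (1 - e) + (1 - (1 - e))) = t ^ size (filter_mset (\<lambda>x. x \<noteq> r) A))"
proof -
  note spec = spectral_mapping[OF A]
  define g where "g = (\<Prod>x\<in>set_mset A - {r}. [:- x, 1:])"
  \<comment> \<open>Lagrange interpolation: 1 at \<open>r\<close>, 0 at the other roots.\<close>
  define p where "p = smult (inverse (poly g r)) g"
  have g: "poly g x = (\<Prod>y\<in>set_mset A - {r}. x - y)" for x
    by (simp add: g_def poly_prod)
  have pr: "poly p r = 1"
    by (simp add: p_def g)
  have px: "poly p x = 0" if "x \<in># A" "x \<noteq> r" for x
    using that by (auto simp: p_def g)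
  \<comment> \<open>The exponent demanded by \<open>nil_power_negligible\<close>.\<close>
  define M where "M = n + 1"
  define P where "P = 1 - (1 - p ^ M) ^ M"
  have P: "poly P x = (if x = r then 1 else 0)" if "x \<in># A" for x
    using that pr px by (auto simp: P_def M_def poly_power)
  have "p ^ M dvd P"
    using one_diff_power_eq[of "1 - p ^ M" M] by (simp add: P_def)
  moreover have "(1 - p) ^ M dvd 1 - P"
  proof -
    have "1 - p dvd 1 - p ^ M" by (simp add: one_diff_power_eq)
    then show ?thesis by (simp add: P_def dvd_power_same)
  qed
  ultimately have "p ^ M * (1 - p) ^ M dvd P * (1 - P)" by (rule mult_dvd_mono)
  moreover have "p ^ M * (1 - p) ^ M = (p - p * p) ^ M"
    by (simp add: power_mult_distrib[symmetric] algebra_simps)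
  ultimately obtain s where s: "P - P * P = (p - p * p) ^ M * s"
    by (auto simp: algebra_simps elim!: dvdE)
  define e where "e = ev P a"
  define c where "c = ev (p - p * p) a"
  have err: "e - e * e = c ^ (n + 1) * ev s a"
    using arg_cong[OF s, of "\<lambda>q. ev q a"]
    by (simp only: ev_diff ev_mult ev_power e_def c_def M_def)
  have ind: "(\<Prod>x\<in>#A. poly q x) = (\<Prod>x\<in>#A. f x)" if "\<And>x. x \<in># A \<Longrightarrow> poly q x = f x" for q f
    using that by (metis (no_types, lifting) image_mset_cong)
  \<comment> \<open>\<open>p - p * p\<close> vanishes at every root of \<open>a\<close>, so spectral
    mapping sees only the constant 1.\<close>
  have nil: "\<phi> (1 + t *\<^sub>C c) = 1" for t
  proof -
    have "1 + t *\<^sub>C c = ev (1 + smult t (p - p * p)) a"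
      by (simp only: ev_add ev_smult ev_1 c_def)
    then have "\<phi> (1 + t *\<^sub>C c) = (\<Prod>x\<in>#A. poly (1 + smult t (p - p * p)) x)"
      by (simp only: spec)
    also have "\<dots> = (\<Prod>x\<in>#A. 1)"
    proof (rule ind)
      fix x assume "x \<in># A"
      then show "poly (1 + smult t (p - p * p)) x = 1"
        using pr px by (cases "x = r") auto
    qed
    finally show ?thesis by simp
  qed
  have "\<phi> (x + (e - e * e) * y) = \<phi> x" for x y
    unfolding err mult.assoc by (rule nil_power_negligible[OF nil])
  moreover have "\<phi> (t *\<^sub>C e + (1 - e)) = t ^ size (filter_mset (\<lambda>x. x = r) A)" for t
  proof -
    have "t *\<^sub>C e + (1 - e) = ev (smult t P + (1 - P)) a"
      by (simp only: ev_add ev_diff ev_smult ev_1 e_def)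
    then have "\<phi> (t *\<^sub>C e + (1 - e)) = (\<Prod>x\<in>#A. poly (smult t P + (1 - P)) x)"
      by (simp only: spec)
    also have "\<dots> = (\<Prod>x\<in>#A. if x = r then t else 1)"
      by (rule ind) (simp add: P)
    finally show ?thesis by (simp only: prod_mset_if)
  qed
  moreover have "\<phi> (t *\<^sub>C (1 - e) + (1 - (1 - e))) = t ^ size (filter_mset (\<lambda>x. x \<noteq> r) A)" for t
  proof -
    have "t *\<^sub>C (1 - e) + (1 - (1 - e)) = ev (smult t (1 - P) + (1 - (1 - P))) a"
      by (simp only: ev_add ev_diff ev_smult ev_1 e_def)
    then have "\<phi> (t *\<^sub>C (1 - e) + (1 - (1 - e)))
        = (\<Prod>x\<in>#A. poly (smult t (1 - P) + (1 - (1 - P))) x)"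
      by (simp only: spec)
    also have "\<dots> = (\<Prod>x\<in>#A. if x \<noteq> r then t else 1)"
      by (rule ind) (simp add: P)
    finally show ?thesis by (simp only: prod_mset_if)
  qed
  ultimately show ?thesis by blast
qed

end

section \<open>Induction on the degree\<close>

lemma homogeneous_character_factorization:
  assumes "homogeneous_character \<phi> n"
  shows "\<exists>hs. (\<forall>h\<in>set hs. algebra_hom h \<and> continuous_on UNIV h) \<and>
    (\<forall>a. \<phi> a = (\<Prod>h\<leftarrow>hs. h a))"
  using assms
proof (induction n arbitrary: \<phi> rule: less_induct)
  case (less n)
  interpret homogeneous_character \<phi> n by (rule less.prems)
  show ?case
  proof (cases "\<forall>a. \<exists>c. \<forall>t. \<phi> (t *\<^sub>C 1 - a) = (t - c) ^ n")
    case True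
    then obtain \<theta> where \<theta>: "\<And>a t. \<phi> (t *\<^sub>C 1 - a) = (t - \<theta> a) ^ n" by metis
    show ?thesis
    proof (cases "n = 0")
      case True
      then have "\<phi> a = 1" for a using \<theta>[of 0 "- a"] by simp
      then show ?thesis by (intro exI[of _ "[]"]) simp
    next
      case False
      then have "n > 0" by simp
      note single_root_character[OF this \<theta>]
      then show ?thesis
        by (intro exI[of _ "replicate n \<theta>"]) (simp add: prod_list_replicate)
    qed
  next
    case False
    then obtain a where a: "\<And>c. \<exists>t. \<phi> (t *\<^sub>C 1 - a) \<noteq> (t - c) ^ n" by blast
    obtain A where A: "size A = n" "\<And>t. \<phi> (t *\<^sub>C 1 - a) = (\<Prod>x\<in>#A. t - x)"
      using char_roots by blast
    have all_eq: False if "\<And>x. x \<in># A \<Longrightarrow> x = c" for c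
    proof -
      have "A = replicate_mset n c"
        using that A(1) by (metis set_mset_subset_singletonD subsetI singletonI)
      then have "\<phi> (t *\<^sub>C 1 - a) = (t - c) ^ n" for t using A(2)[of t] by simp
      with a show False by blast
    qed
    \<comment> \<open>Were \<open>A\<close> empty, \<open>all_eq\<close> would hold vacuously;
      applied to \<open>r\<close> it yields a second root.\<close>
    obtain r where r: "r \<in># A" using all_eq by blast
    obtain r' where r': "r' \<in># A" "r' \<noteq> r" using all_eq by blast
    define m\<^sub>1 where "m\<^sub>1 = size (filter_mset (\<lambda>x. x = r) A)"
    define m\<^sub>2 where "m\<^sub>2 = size (filter_mset (\<lambda>x. x \<noteq> r) A)"
    have "m\<^sub>1 + m\<^sub>2 = n"
      unfolding m\<^sub>1_def m\<^sub>2_def A(1)[symmetric] by (metis multiset_partition size_union)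
    moreover have "m\<^sub>1 \<noteq> 0" "m\<^sub>2 \<noteq> 0"
      using r r' unfolding m\<^sub>1_def m\<^sub>2_def by (auto simp: filter_mset_eq_conv)
    ultimately have m: "m\<^sub>1 < n" "m\<^sub>2 < n" by auto
    from exists_splitting_element[OF A, of r] obtain e
      where e: "\<And>x y. \<phi> (x + (e - e * e) * y) = \<phi> x"
        and e\<^sub>1: "\<And>t. \<phi> (t *\<^sub>C e + (1 - e)) = t ^ m\<^sub>1"
        and e\<^sub>2: "\<And>t. \<phi> (t *\<^sub>C (1 - e) + (1 - (1 - e))) = t ^ m\<^sub>2"
      unfolding m\<^sub>1_def m\<^sub>2_def by blast
    \<comment> \<open>The idempotency defect is symmetric in \<open>e\<close> and
      \<open>1 - e\<close>.\<close>
    have "(1 - e) - (1 - e) * (1 - e) = e - e * e" by (simp add: algebra_simps)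
    then have e': "\<And>x y. \<phi> (x + ((1 - e) - (1 - e) * (1 - e)) * y) = \<phi> x"
      using e by simp
    obtain hs\<^sub>1 where hs\<^sub>1: "\<forall>h\<in>set hs\<^sub>1. algebra_hom h \<and> continuous_on UNIV h"
      "\<And>a. \<phi> (a * e + (1 - e)) = (\<Prod>h\<leftarrow>hs\<^sub>1. h a)"
      using less.IH[OF m(1) corner_character[OF e e\<^sub>1]] by blast
    obtain hs\<^sub>2 where hs\<^sub>2: "\<forall>h\<in>set hs\<^sub>2. algebra_hom h \<and> continuous_on UNIV h"
      "\<And>a. \<phi> (a * (1 - e) + (1 - (1 - e))) = (\<Prod>h\<leftarrow>hs\<^sub>2. h a)"
      using less.IH[OF m(2) corner_character[OF e' e\<^sub>2]] by blast
    have "\<phi> a = (\<Prod>h\<leftarrow>hs\<^sub>1 @ hs\<^sub>2. h a)" for a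
      using corner_product[OF e, of a] unfolding hs\<^sub>1(2) hs\<^sub>2(2) by simp
    with hs\<^sub>1(1) hs\<^sub>2(1) show ?thesis
      by (intro exI[of _ "hs\<^sub>1 @ hs\<^sub>2"]) auto
  qed
qed

section \<open>Reduction to homogeneous characters\<close>

theorem theorem3p3:
  fixes \<phi> :: "'a::unital_comm_complex_banach_algebra \<Rightarrow> complex"
  assumes "holomorphic_character \<phi>"
  shows "\<exists>(n::nat) (h :: nat \<Rightarrow> 'a \<Rightarrow> complex).
    (\<forall>i\<in>{1..n}. algebra_hom (h i) \<and> continuous_on UNIV (h i)) \<and>
    (\<forall>a. \<phi> a = (\<Prod>i=1..n. h i a))"
proof -
  have hol: "holomorphic \<phi>" and mult: "\<And>a b. \<phi> (a * b) = \<phi> a * \<phi> b"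
    using assms by (auto simp: holomorphic_character_def)
  have "\<exists>hs. (\<forall>h\<in>set hs. algebra_hom h \<and> continuous_on UNIV h) \<and>
    (\<forall>a. \<phi> a = (\<Prod>h\<leftarrow>hs. h a))"
  proof (cases "\<phi> 1 = 0")
    case True
    have "\<phi> a = 0" for a using mult[of 1 a] True by simp
    moreover have "complex_linear (\<lambda>a::'a. 0 :: complex)"
      by unfold_locales (simp_all add: scaleC_algebra algebra_simps)
    then have "algebra_hom (\<lambda>a::'a. 0)" by (simp add: algebra_hom_def)
    \<comment> \<open>One zero factor is needed, since the empty product is 1.\<close>
    ultimately show ?thesis by (intro exI[of _ "[\<lambda>a. 0]"]) (simp add: continuous_on_const)
  next
    case False
    with mult[of 1 1] have one: "\<phi> 1 = 1" by simp
    have "\<exists>n. \<forall>c. \<phi> (0 + c *\<^sub>C 1) = c ^ n"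
    proof (rule entire_multiplicative_is_power)
      show "(\<lambda>c. \<phi> (0 + c *\<^sub>C 1)) holomorphic_on UNIV" by (rule holomorphic_on_line[OF hol])
      show "\<phi> (0 + (x * y) *\<^sub>C 1) = \<phi> (0 + x *\<^sub>C 1) * \<phi> (0 + y *\<^sub>C 1)" for x y
        by (simp add: mult[symmetric] scaleC_algebra mult.commute)
    qed (simp add: scaleC_one one)
    then obtain n where "\<And>c. \<phi> (c *\<^sub>C 1) = c ^ n" by auto
    with hol mult have "homogeneous_character \<phi> n" by unfold_locales
    then show ?thesis by (rule homogeneous_character_factorization)
  qed
  then obtain hs where hs: "\<forall>h\<in>set hs. algebra_hom h \<and> continuous_on UNIV h"
    "\<And>a. \<phi> a = (\<Prod>h\<leftarrow>hs. h a)" by blast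
  \<comment> \<open>Lists count from 0, the factors from 1.\<close>
  define h where "h i = hs ! (i - 1)" for i
  have "\<forall>i\<in>{1..length hs}. algebra_hom (h i) \<and> continuous_on UNIV (h i)"
    using hs(1) by (auto simp: h_def)
  moreover have "\<phi> a = (\<Prod>i=1..length hs. h i a)" for a
  proof -
    have "\<phi> a = (\<Prod>i<length hs. (hs ! i) a)"
      unfolding hs(2) by (simp add: prod.list_conv_set_nth atLeast0LessThan)
    also have "\<dots> = (\<Prod>i=1..length hs. h i a)"
      by (rule prod.reindex_bij_witness[where i = "\<lambda>i. i - 1" and j = Suc]) (auto simp: h_def)
    finally show ?thesis .
  qed
  ultimately show ?thesis by blast
qed

end
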